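(* Let $(X,*_0,*_1)$ be mutually distributive racks and let $(X\times X,* )$ be the rack with operation $$(x_0,x_1)*(y_0,y_1)=\bigl((x_0*_0y_0)*_1y_1,\ (x_1*_0y_0)*_1y_1\bigr).$$ Let $A$ be an abelian group and let $\phi_0,\phi_1:X\times X\to A$ be rack 2-cocycles of $(X,*_0)$ and $(X,*_1)$, respectively, such that the pair $(\phi_0,\phi_1)$ is mutually distributive. Then $$\phi((x_0,x_1),(y_0,y_1))=\phi_0(x_0,y_0)+\phi_1(x_0*_0y_0,y_1)+\phi_0(x_1,y_0)+\phi_1(x_1*_0y_0,y_1)$$ is a rack 2-cocycle of $(X\times X,* )$. Moreover, the assignment $(\phi_0,\phi_1)\mapsto\phi$ induces a well-defined map $\Theta:H_L^2(X;A)\to H_R^2(X\times X;A)$.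
   Context: A rack $(X,* )$ is a set with a binary operation such that $(a*b)*c=(a*c)*(b*c)$ and all maps $x\mapsto x*y$ are bijections. Mutually distributive racks $(X,*_0,*_1)$: two rack operations on $X$ with $(x*_0y)*_1z=(x*_1z)*_0(y*_1z)$ and $(x*_1y)*_0z=(x*_0z)*_1(y*_0z)$ for all $x,y,z$. A rack 2-cocycle of $(X,* )$ is a map $\phi:X\times X\to A$ with $\phi(x,y)+\phi(x*y,z)=\phi(x,z)+\phi(x*z,y*z)$ for all $x,y,z$. A pair $(\phi_0,\phi_1)$ is mutually distributive if for all $x,y,z\in X$ $$\phi_0(x,y)+\phi_1(x*_0y,z)=\phi_1(x,z)+\phi_0(x*_1z,y*_1z),\qquad \phi_1(x,y)+\phi_0(x*_1y,z)=\phi_0(x,z)+\phi_1(x*_0z,y*_0z).$$ $H^2_R(Y;A)$, for a rack $(Y,* )$, is the group of rack 2-cocycles modulo the 2-coboundaries, i.e. the maps of the form $(x,y)\mapsto f(x)-f(x*y)$ with $f:Y\to A$. $H^2_L(X;A)$ is the second labeled cohomology group: the group of pairs $(\phi_0,\phi_1)$ such that $\phi_\epsilon$ is a rack 2-cocycle of $(X,*_\epsilon)$ for $\epsilon=0,1$ and $(\phi_0,\phi_1)$ is mutually distributive, modulo the pairs of the form $\phi_\epsilon(x,y)=f(x)-f(x*_\epsilon y)$ ($\epsilon=0,1$) for a single map $f:X\to A$. *)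

theory Defs
  imports "HOL-Algebra.Product_Groups"
begin

section \<open>Racks and mutually distributive racks\<close>

locale rack =
  fixes X :: "'x set" and tri :: "'x \<Rightarrow> 'x \<Rightarrow> 'x" (infixl "\<triangleleft>" 70)
  assumes closed: "\<lbrakk>x \<in> X; y \<in> X\<rbrakk> \<Longrightarrow> x \<triangleleft> y \<in> X"
    and self_distrib: "\<lbrakk>a \<in> X; b \<in> X; c \<in> X\<rbrakk> \<Longrightarrow> (a \<triangleleft> b) \<triangleleft> c = (a \<triangleleft> c) \<triangleleft> (b \<triangleleft> c)"
    and bij_right: "y \<in> X \<Longrightarrow> bij_betw (\<lambda>x. x \<triangleleft> y) X X"

locale mutually_distributive_racks =
  r0: rack X tri0 + r1: rack X tri1
  for X :: "'x set"
    and tri0 :: "'x \<Rightarrow> 'x \<Rightarrow> 'x" (infixl "\<triangleleft>\<^sub>0" 70)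
    and tri1 :: "'x \<Rightarrow> 'x \<Rightarrow> 'x" (infixl "\<triangleleft>\<^sub>1" 70) +
  assumes distrib01: "\<lbrakk>x \<in> X; y \<in> X; z \<in> X\<rbrakk> \<Longrightarrow> (x \<triangleleft>\<^sub>0 y) \<triangleleft>\<^sub>1 z = (x \<triangleleft>\<^sub>1 z) \<triangleleft>\<^sub>0 (y \<triangleleft>\<^sub>1 z)"
    and distrib10: "\<lbrakk>x \<in> X; y \<in> X; z \<in> X\<rbrakk> \<Longrightarrow> (x \<triangleleft>\<^sub>1 y) \<triangleleft>\<^sub>0 z = (x \<triangleleft>\<^sub>0 z) \<triangleleft>\<^sub>1 (y \<triangleleft>\<^sub>0 z)"

section \<open>Cocycles and coboundaries\<close>

text \<open>
  The coefficient group is a \<^locale>\<open>comm_group\<close>, hence written multiplicatively: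
  a sum in the coefficients becomes a product, and a difference a product with an inverse.
\<close>

definition rack_2cocycle ::
    "'x set \<Rightarrow> ('x \<Rightarrow> 'x \<Rightarrow> 'x) \<Rightarrow> ('a, 'm) monoid_scheme \<Rightarrow> ('x \<times> 'x \<Rightarrow> 'a) \<Rightarrow> bool" where
  "rack_2cocycle X tri A \<phi> \<longleftrightarrow>
     \<phi> \<in> X \<times> X \<rightarrow> carrier A \<and>
     (\<forall>x\<in>X. \<forall>y\<in>X. \<forall>z\<in>X.
        \<phi> (x, y) \<otimes>\<^bsub>A\<^esub> \<phi> (x \<triangleleft> y, z) = \<phi> (x, z) \<otimes>\<^bsub>A\<^esub> \<phi> (x \<triangleleft> z, y \<triangleleft> z))"
  for tri (infixl "\<triangleleft>" 70)

definition mutually_distributive_pair ::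
    "'x set \<Rightarrow> ('x \<Rightarrow> 'x \<Rightarrow> 'x) \<Rightarrow> ('x \<Rightarrow> 'x \<Rightarrow> 'x) \<Rightarrow> ('a, 'm) monoid_scheme \<Rightarrow>
     ('x \<times> 'x \<Rightarrow> 'a) \<Rightarrow> ('x \<times> 'x \<Rightarrow> 'a) \<Rightarrow> bool" where
  "mutually_distributive_pair X tri0 tri1 A \<phi>0 \<phi>1 \<longleftrightarrow>
     (\<forall>x\<in>X. \<forall>y\<in>X. \<forall>z\<in>X.
        \<phi>0 (x, y) \<otimes>\<^bsub>A\<^esub> \<phi>1 (x \<triangleleft>\<^sub>0 y, z) = \<phi>1 (x, z) \<otimes>\<^bsub>A\<^esub> \<phi>0 (x \<triangleleft>\<^sub>1 z, y \<triangleleft>\<^sub>1 z) \<and>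
        \<phi>1 (x, y) \<otimes>\<^bsub>A\<^esub> \<phi>0 (x \<triangleleft>\<^sub>1 y, z) = \<phi>0 (x, z) \<otimes>\<^bsub>A\<^esub> \<phi>1 (x \<triangleleft>\<^sub>0 z, y \<triangleleft>\<^sub>0 z))"
  for tri0 (infixl "\<triangleleft>\<^sub>0" 70) and tri1 (infixl "\<triangleleft>\<^sub>1" 70)

definition coboundary ::
    "'x set \<Rightarrow> ('x \<Rightarrow> 'x \<Rightarrow> 'x) \<Rightarrow> ('a, 'm) monoid_scheme \<Rightarrow> ('x \<Rightarrow> 'a) \<Rightarrow> ('x \<times> 'x \<Rightarrow> 'a)" where
  "coboundary X tri A f = (\<lambda>(x, y) \<in> X \<times> X. f x \<otimes>\<^bsub>A\<^esub> inv\<^bsub>A\<^esub> f (x \<triangleleft> y))"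
  for tri (infixl "\<triangleleft>" 70)

section \<open>Cohomology groups\<close>

text \<open>
  A 2-cochain is an element of the product of copies of \<open>A\<close> indexed by \<open>X \<times> X\<close>. Its elements
  are extensional functions, so that cochains agreeing on \<open>X \<times> X\<close> are equal.
\<close>

abbreviation cochain_group ::
    "'x set \<Rightarrow> ('a, 'm) monoid_scheme \<Rightarrow> ('x \<times> 'x \<Rightarrow> 'a) monoid" where
  "cochain_group X A \<equiv> product_group (X \<times> X) (\<lambda>_. A)"

definition rack_Z2 ::
    "'x set \<Rightarrow> ('x \<Rightarrow> 'x \<Rightarrow> 'x) \<Rightarrow> ('a, 'm) monoid_scheme \<Rightarrow> ('x \<times> 'x \<Rightarrow> 'a) monoid" where
  "rack_Z2 X tri A =
     (cochain_group X A)
       \<lparr>carrier := {\<phi> \<in> carrier (cochain_group X A). rack_2cocycle X tri A \<phi>}\<rparr>"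

definition rack_B2 ::
    "'x set \<Rightarrow> ('x \<Rightarrow> 'x \<Rightarrow> 'x) \<Rightarrow> ('a, 'm) monoid_scheme \<Rightarrow> ('x \<times> 'x \<Rightarrow> 'a) set" where
  "rack_B2 X tri A = coboundary X tri A ` (X \<rightarrow> carrier A)"

definition rack_H2 ::
    "'x set \<Rightarrow> ('x \<Rightarrow> 'x \<Rightarrow> 'x) \<Rightarrow> ('a, 'm) monoid_scheme \<Rightarrow> ('x \<times> 'x \<Rightarrow> 'a) set monoid" where
  "rack_H2 X tri A = rack_Z2 X tri A Mod rack_B2 X tri A"

definition rack_class ::
    "'x set \<Rightarrow> ('x \<Rightarrow> 'x \<Rightarrow> 'x) \<Rightarrow> ('a, 'm) monoid_scheme \<Rightarrow> ('x \<times> 'x \<Rightarrow> 'a) \<Rightarrow>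
     ('x \<times> 'x \<Rightarrow> 'a) set" where
  "rack_class X tri A \<phi> = rack_B2 X tri A #>\<^bsub>rack_Z2 X tri A\<^esub> \<phi>"

definition labeled_Z2 ::
    "'x set \<Rightarrow> ('x \<Rightarrow> 'x \<Rightarrow> 'x) \<Rightarrow> ('x \<Rightarrow> 'x \<Rightarrow> 'x) \<Rightarrow> ('a, 'm) monoid_scheme \<Rightarrow>
     (('x \<times> 'x \<Rightarrow> 'a) \<times> ('x \<times> 'x \<Rightarrow> 'a)) monoid" where
  "labeled_Z2 X tri0 tri1 A =
     (cochain_group X A \<times>\<times> cochain_group X A)
       \<lparr>carrier := {(\<phi>0, \<phi>1) \<in> carrier (cochain_group X A \<times>\<times> cochain_group X A).
          rack_2cocycle X tri0 A \<phi>0 \<and> rack_2cocycle X tri1 A \<phi>1 \<and>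
          mutually_distributive_pair X tri0 tri1 A \<phi>0 \<phi>1}\<rparr>"

definition labeled_B2 ::
    "'x set \<Rightarrow> ('x \<Rightarrow> 'x \<Rightarrow> 'x) \<Rightarrow> ('x \<Rightarrow> 'x \<Rightarrow> 'x) \<Rightarrow> ('a, 'm) monoid_scheme \<Rightarrow>
     (('x \<times> 'x \<Rightarrow> 'a) \<times> ('x \<times> 'x \<Rightarrow> 'a)) set" where
  "labeled_B2 X tri0 tri1 A =
     (\<lambda>f. (coboundary X tri0 A f, coboundary X tri1 A f)) ` (X \<rightarrow> carrier A)"

definition labeled_H2 ::
    "'x set \<Rightarrow> ('x \<Rightarrow> 'x \<Rightarrow> 'x) \<Rightarrow> ('x \<Rightarrow> 'x \<Rightarrow> 'x) \<Rightarrow> ('a, 'm) monoid_scheme \<Rightarrow>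
     (('x \<times> 'x \<Rightarrow> 'a) \<times> ('x \<times> 'x \<Rightarrow> 'a)) set monoid" where
  "labeled_H2 X tri0 tri1 A = labeled_Z2 X tri0 tri1 A Mod labeled_B2 X tri0 tri1 A"

definition labeled_class ::
    "'x set \<Rightarrow> ('x \<Rightarrow> 'x \<Rightarrow> 'x) \<Rightarrow> ('x \<Rightarrow> 'x \<Rightarrow> 'x) \<Rightarrow> ('a, 'm) monoid_scheme \<Rightarrow>
     ('x \<times> 'x \<Rightarrow> 'a) \<Rightarrow> ('x \<times> 'x \<Rightarrow> 'a) \<Rightarrow>
     (('x \<times> 'x \<Rightarrow> 'a) \<times> ('x \<times> 'x \<Rightarrow> 'a)) set" where
  "labeled_class X tri0 tri1 A \<phi>0 \<phi>1 =
     labeled_B2 X tri0 tri1 A #>\<^bsub>labeled_Z2 X tri0 tri1 A\<^esub> (\<phi>0, \<phi>1)"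

section \<open>The quotients are abelian groups\<close>

lemma comm_group_cochain_group:
  assumes "comm_group A"
  shows "comm_group (cochain_group X A)"
proof -
  interpret comm_group A by fact
  show ?thesis
    by (rule group.group_comm_groupI)
       (auto simp: is_group PiE_iff fun_eq_iff restrict_def m_comm)
qed

lemma comm_group_DirProd:
  assumes "comm_group G" "comm_group H"
  shows "comm_group (G \<times>\<times> H)"
proof -
  interpret G: comm_group G by fact
  interpret H: comm_group H by fact
  show ?thesis
    by (rule group.group_comm_groupI)
       (auto simp: DirProd_group G.is_group H.is_group G.m_comm H.m_comm)
qed

lemma (in comm_group) comm_group_subgroup:
  "subgroup H G \<Longrightarrow> comm_group (G\<lparr>carrier := H\<rparr>)"
  by (rule group.group_comm_groupI)
     (auto simp: subgroup_imp_group m_comm subgroup.mem_carrier)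

lemma (in comm_group) mult_eq_interchange:
  assumes "a \<in> carrier G" "b \<in> carrier G" "c \<in> carrier G" "d \<in> carrier G"
    and "e \<in> carrier G" "f \<in> carrier G" "g \<in> carrier G" "h \<in> carrier G"
    and "a \<otimes> b = c \<otimes> d" "e \<otimes> f = g \<otimes> h"
  shows "(a \<otimes> e) \<otimes> (b \<otimes> f) = (c \<otimes> g) \<otimes> (d \<otimes> h)"
proof -
  have "(a \<otimes> e) \<otimes> (b \<otimes> f) = (a \<otimes> b) \<otimes> (e \<otimes> f)"
    using assms(1-8) by (simp add: m_ac)
  also have "\<dots> = (c \<otimes> d) \<otimes> (g \<otimes> h)"
    using assms(9,10) by simp
  also have "\<dots> = (c \<otimes> g) \<otimes> (d \<otimes> h)"
    using assms(1-8) by (simp add: m_ac)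
  finally show "(a \<otimes> e) \<otimes> (b \<otimes> f) = (c \<otimes> g) \<otimes> (d \<otimes> h)" .
qed

lemma (in comm_group) inv_mult_inv_cong:
  assumes "a \<in> carrier G" "b \<in> carrier G" "c \<in> carrier G" "d \<in> carrier G"
    and "a \<otimes> b = c \<otimes> d"
  shows "inv a \<otimes> inv b = inv c \<otimes> inv d"
  using assms by (metis inv_mult)

lemma (in comm_group) mult_inv_cancel_middle:
  assumes "a \<in> carrier G" "b \<in> carrier G" "c \<in> carrier G"
  shows "(a \<otimes> inv b) \<otimes> (b \<otimes> inv c) = a \<otimes> inv c"
proof -
  have "(a \<otimes> inv b) \<otimes> (b \<otimes> inv c) = a \<otimes> ((inv b \<otimes> b) \<otimes> inv c)"
    using assms by (simp only: m_assoc inv_closed m_closed)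
  then show ?thesis
    using assms by simp
qed

lemma rack_2cocycle_closed:
  "\<lbrakk>rack_2cocycle X tri A \<phi>; x \<in> X; y \<in> X\<rbrakk> \<Longrightarrow> \<phi> (x, y) \<in> carrier A"
  by (auto simp: rack_2cocycle_def)

lemma rack_2cocycle_eq:
  "\<lbrakk>rack_2cocycle X tri A \<phi>; x \<in> X; y \<in> X; z \<in> X\<rbrakk> \<Longrightarrow>
    \<phi> (x, y) \<otimes>\<^bsub>A\<^esub> \<phi> (tri x y, z) = \<phi> (x, z) \<otimes>\<^bsub>A\<^esub> \<phi> (tri x z, tri y z)"
  by (auto simp: rack_2cocycle_def)

lemma mutually_distributive_pair_eq:
  assumes "mutually_distributive_pair X tri0 tri1 A \<phi>0 \<phi>1" "x \<in> X" "y \<in> X" "z \<in> X"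
  shows "\<phi>0 (x, y) \<otimes>\<^bsub>A\<^esub> \<phi>1 (tri0 x y, z) = \<phi>1 (x, z) \<otimes>\<^bsub>A\<^esub> \<phi>0 (tri1 x z, tri1 y z)"
    and "\<phi>1 (x, y) \<otimes>\<^bsub>A\<^esub> \<phi>0 (tri1 x y, z) = \<phi>0 (x, z) \<otimes>\<^bsub>A\<^esub> \<phi>1 (tri0 x z, tri0 y z)"
  using assms by (auto simp: mutually_distributive_pair_def)

lemma (in rack) rack_2cocycle_one:
  assumes "comm_group A"
  shows "rack_2cocycle X (\<triangleleft>) A \<one>\<^bsub>cochain_group X A\<^esub>"
proof -
  interpret A: comm_group A by fact
  show ?thesis by (auto simp: rack_2cocycle_def closed)
qed

lemma (in rack) rack_2cocycle_mult:
  assumes "comm_group A" and c: "rack_2cocycle X (\<triangleleft>) A \<phi>" "rack_2cocycle X (\<triangleleft>) A \<psi>"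
  shows "rack_2cocycle X (\<triangleleft>) A (\<phi> \<otimes>\<^bsub>cochain_group X A\<^esub> \<psi>)"
proof -
  interpret A: comm_group A by fact
  show ?thesis
    unfolding rack_2cocycle_def[of X "(\<triangleleft>)" A "_ \<otimes>\<^bsub>_\<^esub> _"]
    by (auto simp: closed c[THEN rack_2cocycle_closed]
        intro!: A.mult_eq_interchange c[THEN rack_2cocycle_eq])
qed

lemma (in rack) rack_2cocycle_inv:
  assumes "comm_group A" "\<phi> \<in> carrier (cochain_group X A)" and c: "rack_2cocycle X (\<triangleleft>) A \<phi>"
  shows "rack_2cocycle X (\<triangleleft>) A (inv\<^bsub>cochain_group X A\<^esub> \<phi>)"
proof -
  interpret A: comm_group A by fact
  have "inv\<^bsub>cochain_group X A\<^esub> \<phi> = (\<lambda>i\<in>X \<times> X. inv\<^bsub>A\<^esub> \<phi> i)"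
    using assms(2) by (simp add: A.is_group)
  then show ?thesis
    unfolding rack_2cocycle_def[of X "(\<triangleleft>)" A "inv\<^bsub>_\<^esub> _"]
    by (auto simp: closed c[THEN rack_2cocycle_closed]
        intro!: A.inv_mult_inv_cong c[THEN rack_2cocycle_eq])
qed

lemma (in rack) rack_2cocycle_subgroup:
  assumes "comm_group A"
  shows "subgroup (carrier (rack_Z2 X (\<triangleleft>) A)) (cochain_group X A)"
proof -
  interpret C: comm_group "cochain_group X A"
    by (rule comm_group_cochain_group[OF assms])
  have Z: "\<phi> \<in> carrier (rack_Z2 X (\<triangleleft>) A) \<longleftrightarrow>
      \<phi> \<in> carrier (cochain_group X A) \<and> rack_2cocycle X (\<triangleleft>) A \<phi>" for \<phi>
    by (simp add: rack_Z2_def)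
  show ?thesis
    by (rule C.subgroupI, unfold Z)
       (use Z C.one_closed rack_2cocycle_one[OF assms] in
          \<open>blast intro: C.inv_closed C.m_closed rack_2cocycle_inv[OF assms] rack_2cocycle_mult[OF assms]\<close>)+
qed

lemma coboundary_one:
  assumes "comm_group A"
  shows "coboundary X tri A (\<lambda>_. \<one>\<^bsub>A\<^esub>) = \<one>\<^bsub>cochain_group X A\<^esub>"
proof -
  interpret comm_group A by fact
  show ?thesis by (auto simp: coboundary_def restrict_def)
qed

lemma (in rack) coboundary_mult:
  assumes "comm_group A" "f \<in> X \<rightarrow> carrier A" "g \<in> X \<rightarrow> carrier A"
  shows "coboundary X (\<triangleleft>) A f \<otimes>\<^bsub>cochain_group X A\<^esub> coboundary X (\<triangleleft>) A g =
    coboundary X (\<triangleleft>) A (\<lambda>x. f x \<otimes>\<^bsub>A\<^esub> g x)"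
proof -
  interpret comm_group A by fact
  show ?thesis
    using assms(2,3)
    by (auto simp: coboundary_def restrict_def fun_eq_iff Pi_iff closed inv_mult m_ac)
qed

lemma (in rack) coboundary_cochain:
  assumes "comm_group A" "f \<in> X \<rightarrow> carrier A"
  shows "coboundary X (\<triangleleft>) A f \<in> carrier (cochain_group X A)"
proof -
  interpret comm_group A by fact
  show ?thesis
    using assms(2) by (auto simp: coboundary_def Pi_iff closed)
qed

lemma (in rack) coboundary_inv:
  assumes "comm_group A" "f \<in> X \<rightarrow> carrier A"
  shows "inv\<^bsub>cochain_group X A\<^esub> (coboundary X (\<triangleleft>) A f) =
    coboundary X (\<triangleleft>) A (\<lambda>x. inv\<^bsub>A\<^esub> f x)"
proof -
  interpret A: comm_group A by fact
  interpret C: comm_group "cochain_group X A"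
    by (rule comm_group_cochain_group[OF assms(1)])
  have "(\<lambda>x. inv\<^bsub>A\<^esub> f x) \<in> X \<rightarrow> carrier A"
    using assms(2) by auto
  moreover have "coboundary X (\<triangleleft>) A (\<lambda>x. inv\<^bsub>A\<^esub> f x \<otimes>\<^bsub>A\<^esub> f x) =
      coboundary X (\<triangleleft>) A (\<lambda>_. \<one>\<^bsub>A\<^esub>)"
    using assms(2) by (auto simp: coboundary_def restrict_def fun_eq_iff Pi_iff closed)
  ultimately show ?thesis
    using assms by (intro C.inv_equality) (simp_all only: coboundary_mult coboundary_one coboundary_cochain)
qed

lemma (in rack) coboundary_2cocycle:
  assumes "comm_group A" "f \<in> X \<rightarrow> carrier A"
  shows "rack_2cocycle X (\<triangleleft>) A (coboundary X (\<triangleleft>) A f)"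
proof -
  interpret A: comm_group A by fact
  have [simp]: "f x \<in> carrier A" if "x \<in> X" for x using assms(2) that by auto
  show ?thesis
    unfolding rack_2cocycle_def
    by (auto simp: coboundary_def closed A.mult_inv_cancel_middle self_distrib[symmetric])
qed

theorem (in rack) comm_group_rack_H2:
  assumes "comm_group A"
  shows "comm_group (rack_H2 X (\<triangleleft>) A)"
proof -
  interpret A: comm_group A by fact
  interpret C: comm_group "cochain_group X A"
    by (rule comm_group_cochain_group[OF assms])
  have Z: "rack_Z2 X (\<triangleleft>) A = (cochain_group X A)\<lparr>carrier := carrier (rack_Z2 X (\<triangleleft>) A)\<rparr>"
    by (simp add: rack_Z2_def)
  have B: "subgroup (rack_B2 X (\<triangleleft>) A) (cochain_group X A)"
  proof (rule C.subgroupI)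
    show "rack_B2 X (\<triangleleft>) A \<noteq> {}" by (auto simp: rack_B2_def)
  next
    fix \<phi> assume "\<phi> \<in> rack_B2 X (\<triangleleft>) A"
    then obtain f where f: "f \<in> X \<rightarrow> carrier A" "\<phi> = coboundary X (\<triangleleft>) A f"
      by (auto simp: rack_B2_def)
    then have "(\<lambda>x. inv\<^bsub>A\<^esub> f x) \<in> X \<rightarrow> carrier A" by auto
    then show "inv\<^bsub>cochain_group X A\<^esub> \<phi> \<in> rack_B2 X (\<triangleleft>) A"
      using coboundary_inv[OF assms f(1)] f(2) unfolding rack_B2_def by (metis imageI)
  next
    fix \<phi> \<psi> assume "\<phi> \<in> rack_B2 X (\<triangleleft>) A" "\<psi> \<in> rack_B2 X (\<triangleleft>) A"
    then obtain f g where fg: "f \<in> X \<rightarrow> carrier A" "g \<in> X \<rightarrow> carrier A"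
      "\<phi> = coboundary X (\<triangleleft>) A f" "\<psi> = coboundary X (\<triangleleft>) A g"
      by (auto simp: rack_B2_def)
    then have "(\<lambda>x. f x \<otimes>\<^bsub>A\<^esub> g x) \<in> X \<rightarrow> carrier A" by auto
    then show "\<phi> \<otimes>\<^bsub>cochain_group X A\<^esub> \<psi> \<in> rack_B2 X (\<triangleleft>) A"
      using coboundary_mult[OF assms fg(1,2)] fg(3,4) unfolding rack_B2_def by (metis imageI)
  next
    show "rack_B2 X (\<triangleleft>) A \<subseteq> carrier (cochain_group X A)"
      unfolding rack_B2_def using coboundary_cochain[OF assms] by blast
  qed
  have "rack_B2 X (\<triangleleft>) A \<subseteq> carrier (rack_Z2 X (\<triangleleft>) A)"
    using coboundary_2cocycle[OF assms] coboundary_cochain[OF assms]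
    unfolding rack_B2_def rack_Z2_def by auto
  then have "subgroup (rack_B2 X (\<triangleleft>) A) (rack_Z2 X (\<triangleleft>) A)"
    using C.subgroup_incl[OF B rack_2cocycle_subgroup[OF assms]] Z by simp
  moreover have "comm_group (rack_Z2 X (\<triangleleft>) A)"
    using C.comm_group_subgroup[OF rack_2cocycle_subgroup[OF assms]] Z by simp
  ultimately show ?thesis
    unfolding rack_H2_def by (simp add: comm_group.abelian_FactGroup)
qed

context mutually_distributive_racks
begin

lemma mutually_distributive_pair_one:
  assumes "comm_group A"
  shows "mutually_distributive_pair X (\<triangleleft>\<^sub>0) (\<triangleleft>\<^sub>1) A \<one>\<^bsub>cochain_group X A\<^esub> \<one>\<^bsub>cochain_group X A\<^esub>"
  by (auto simp: mutually_distributive_pair_def r0.closed r1.closed)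

lemma mutually_distributive_pair_mult:
  assumes "comm_group A"
    and c0: "rack_2cocycle X (\<triangleleft>\<^sub>0) A \<phi>0" "rack_2cocycle X (\<triangleleft>\<^sub>0) A \<psi>0"
    and c1: "rack_2cocycle X (\<triangleleft>\<^sub>1) A \<phi>1" "rack_2cocycle X (\<triangleleft>\<^sub>1) A \<psi>1"
    and m: "mutually_distributive_pair X (\<triangleleft>\<^sub>0) (\<triangleleft>\<^sub>1) A \<phi>0 \<phi>1"
      "mutually_distributive_pair X (\<triangleleft>\<^sub>0) (\<triangleleft>\<^sub>1) A \<psi>0 \<psi>1"
  shows "mutually_distributive_pair X (\<triangleleft>\<^sub>0) (\<triangleleft>\<^sub>1) A
    (\<phi>0 \<otimes>\<^bsub>cochain_group X A\<^esub> \<psi>0) (\<phi>1 \<otimes>\<^bsub>cochain_group X A\<^esub> \<psi>1)"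
proof -
  interpret A: comm_group A by fact
  show ?thesis
    unfolding mutually_distributive_pair_def[of X "(\<triangleleft>\<^sub>0)" "(\<triangleleft>\<^sub>1)" A "_ \<otimes>\<^bsub>_\<^esub> _"]
    by (auto simp: r0.closed r1.closed c0[THEN rack_2cocycle_closed] c1[THEN rack_2cocycle_closed]
        intro!: A.mult_eq_interchange m[THEN mutually_distributive_pair_eq(1)]
          m[THEN mutually_distributive_pair_eq(2)])
qed

lemma mutually_distributive_pair_inv:
  assumes "comm_group A" "\<phi>0 \<in> carrier (cochain_group X A)" "\<phi>1 \<in> carrier (cochain_group X A)"
    and c: "rack_2cocycle X (\<triangleleft>\<^sub>0) A \<phi>0" "rack_2cocycle X (\<triangleleft>\<^sub>1) A \<phi>1"
    and m: "mutually_distributive_pair X (\<triangleleft>\<^sub>0) (\<triangleleft>\<^sub>1) A \<phi>0 \<phi>1"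
  shows "mutually_distributive_pair X (\<triangleleft>\<^sub>0) (\<triangleleft>\<^sub>1) A
    (inv\<^bsub>cochain_group X A\<^esub> \<phi>0) (inv\<^bsub>cochain_group X A\<^esub> \<phi>1)"
proof -
  interpret A: comm_group A by fact
  have "inv\<^bsub>cochain_group X A\<^esub> \<phi> = (\<lambda>i\<in>X \<times> X. inv\<^bsub>A\<^esub> \<phi> i)"
    if "\<phi> \<in> carrier (cochain_group X A)" for \<phi>
    using that by (simp add: A.is_group)
  note inv = this[OF assms(2)] this[OF assms(3)]
  show ?thesis
    unfolding inv mutually_distributive_pair_def[of X "(\<triangleleft>\<^sub>0)" "(\<triangleleft>\<^sub>1)" A "restrict _ _"]
    by (auto simp: r0.closed r1.closed c[THEN rack_2cocycle_closed]
        intro!: A.inv_mult_inv_cong mutually_distributive_pair_eq[OF m])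
qed

lemma labeled_2cocycle_subgroup:
  assumes "comm_group A"
  shows "subgroup (carrier (labeled_Z2 X (\<triangleleft>\<^sub>0) (\<triangleleft>\<^sub>1) A)) (cochain_group X A \<times>\<times> cochain_group X A)"
proof -
  let ?C = "cochain_group X A" and ?Z = "labeled_Z2 X (\<triangleleft>\<^sub>0) (\<triangleleft>\<^sub>1) A"
  interpret C: comm_group ?C
    by (rule comm_group_cochain_group[OF assms])
  interpret D: comm_group "?C \<times>\<times> ?C"
    by (intro comm_group_DirProd comm_group_cochain_group assms)
  have Z: "(\<phi>, \<psi>) \<in> carrier ?Z \<longleftrightarrow> \<phi> \<in> carrier ?C \<and> \<psi> \<in> carrier ?C \<and>
      rack_2cocycle X (\<triangleleft>\<^sub>0) A \<phi> \<and> rack_2cocycle X (\<triangleleft>\<^sub>1) A \<psi> \<and>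
      mutually_distributive_pair X (\<triangleleft>\<^sub>0) (\<triangleleft>\<^sub>1) A \<phi> \<psi>" for \<phi> \<psi>
    by (auto simp: labeled_Z2_def)
  show ?thesis
  proof (rule D.subgroupI)
    have "(\<one>\<^bsub>?C\<^esub>, \<one>\<^bsub>?C\<^esub>) \<in> carrier ?Z"
      unfolding Z
      by (intro conjI C.one_closed r0.rack_2cocycle_one r1.rack_2cocycle_one
          mutually_distributive_pair_one assms)
    then show "carrier ?Z \<noteq> {}" by blast
  next
    fix p assume p: "p \<in> carrier ?Z"
    obtain \<phi> \<psi> where pq: "p = (\<phi>, \<psi>)" by (cases p)
    note z = p[unfolded pq Z]
    have "inv\<^bsub>?C \<times>\<times> ?C\<^esub> p = (inv\<^bsub>?C\<^esub> \<phi>, inv\<^bsub>?C\<^esub> \<psi>)"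
      unfolding pq using z by (intro inv_DirProd C.is_group) blast+
    moreover have "(inv\<^bsub>?C\<^esub> \<phi>, inv\<^bsub>?C\<^esub> \<psi>) \<in> carrier ?Z"
      unfolding Z using z
      by (intro conjI C.inv_closed r0.rack_2cocycle_inv r1.rack_2cocycle_inv
          mutually_distributive_pair_inv assms) blast+
    ultimately show "inv\<^bsub>?C \<times>\<times> ?C\<^esub> p \<in> carrier ?Z" by (simp only:)
  next
    fix p q assume p: "p \<in> carrier ?Z" and q: "q \<in> carrier ?Z"
    obtain \<phi> \<psi> \<phi>' \<psi>' where pq: "p = (\<phi>, \<psi>)" "q = (\<phi>', \<psi>')" by (cases p, cases q)
    note z = p[unfolded pq Z] q[unfolded pq Z]
    show "p \<otimes>\<^bsub>?C \<times>\<times> ?C\<^esub> q \<in> carrier ?Z"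
      unfolding pq mult_DirProd Z using z
      by (intro conjI C.m_closed r0.rack_2cocycle_mult r1.rack_2cocycle_mult
          mutually_distributive_pair_mult assms) blast+
  qed (auto simp: labeled_Z2_def)
qed

lemma coboundary_mutually_distributive_pair:
  assumes "comm_group A" "f \<in> X \<rightarrow> carrier A"
  shows "mutually_distributive_pair X (\<triangleleft>\<^sub>0) (\<triangleleft>\<^sub>1) A (coboundary X (\<triangleleft>\<^sub>0) A f) (coboundary X (\<triangleleft>\<^sub>1) A f)"
proof -
  interpret A: comm_group A by fact
  have [simp]: "f x \<in> carrier A" if "x \<in> X" for x using assms(2) that by auto
  show ?thesis
    unfolding mutually_distributive_pair_def
    by (auto simp: coboundary_def r0.closed r1.closed A.mult_inv_cancel_middle
        distrib01[symmetric] distrib10[symmetric])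
qed

theorem comm_group_labeled_H2:
  assumes "comm_group A"
  shows "comm_group (labeled_H2 X (\<triangleleft>\<^sub>0) (\<triangleleft>\<^sub>1) A)"
proof -
  interpret A: comm_group A by fact
  interpret C: comm_group "cochain_group X A"
    by (rule comm_group_cochain_group[OF assms])
  let ?D = "cochain_group X A \<times>\<times> cochain_group X A"
  interpret D: comm_group ?D
    by (intro comm_group_DirProd comm_group_cochain_group assms)
  let ?Z = "labeled_Z2 X (\<triangleleft>\<^sub>0) (\<triangleleft>\<^sub>1) A" and ?B = "labeled_B2 X (\<triangleleft>\<^sub>0) (\<triangleleft>\<^sub>1) A"
  let ?d = "\<lambda>f. (coboundary X (\<triangleleft>\<^sub>0) A f, coboundary X (\<triangleleft>\<^sub>1) A f)"
  have Z: "?Z = ?D\<lparr>carrier := carrier ?Z\<rparr>"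
    by (simp add: labeled_Z2_def)
  note cochain = r0.coboundary_cochain[OF assms] r1.coboundary_cochain[OF assms]
  have B: "subgroup ?B ?D"
  proof (rule D.subgroupI)
    show "?B \<noteq> {}" by (auto simp: labeled_B2_def)
  next
    fix p assume "p \<in> ?B"
    then obtain f where f: "f \<in> X \<rightarrow> carrier A" "p = ?d f"
      by (auto simp: labeled_B2_def)
    then have "(\<lambda>x. inv\<^bsub>A\<^esub> f x) \<in> X \<rightarrow> carrier A" by auto
    moreover have "inv\<^bsub>?D\<^esub> p = ?d (\<lambda>x. inv\<^bsub>A\<^esub> f x)"
      unfolding f(2) inv_DirProd[OF C.is_group C.is_group cochain[OF f(1)]]
      by (simp only: r0.coboundary_inv[OF assms f(1)] r1.coboundary_inv[OF assms f(1)])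
    ultimately show "inv\<^bsub>?D\<^esub> p \<in> ?B"
      unfolding labeled_B2_def by blast
  next
    fix p q assume "p \<in> ?B" "q \<in> ?B"
    then obtain f g where fg: "f \<in> X \<rightarrow> carrier A" "g \<in> X \<rightarrow> carrier A" "p = ?d f" "q = ?d g"
      by (auto simp: labeled_B2_def)
    then have "(\<lambda>x. f x \<otimes>\<^bsub>A\<^esub> g x) \<in> X \<rightarrow> carrier A" by auto
    moreover have "p \<otimes>\<^bsub>?D\<^esub> q = ?d (\<lambda>x. f x \<otimes>\<^bsub>A\<^esub> g x)"
      unfolding fg(3,4) mult_DirProd
      by (simp only: r0.coboundary_mult[OF assms fg(1,2)] r1.coboundary_mult[OF assms fg(1,2)])
    ultimately show "p \<otimes>\<^bsub>?D\<^esub> q \<in> ?B"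
      unfolding labeled_B2_def by blast
  next
    show "?B \<subseteq> carrier ?D"
      unfolding labeled_B2_def carrier_DirProd using cochain by blast
  qed
  have "?B \<subseteq> carrier ?Z"
    using cochain r0.coboundary_2cocycle[OF assms] r1.coboundary_2cocycle[OF assms]
      coboundary_mutually_distributive_pair[OF assms]
    unfolding labeled_B2_def labeled_Z2_def
    by (auto simp del: carrier_product_group)
  then have "subgroup ?B ?Z"
    using D.subgroup_incl[OF B labeled_2cocycle_subgroup[OF assms]] Z by simp
  moreover have "comm_group ?Z"
    using D.comm_group_subgroup[OF labeled_2cocycle_subgroup[OF assms]] Z by simp
  ultimately show ?thesis
    unfolding labeled_H2_def by (simp add: comm_group.abelian_FactGroup)
qed

end

section \<open>The doubling construction\<close>

definition double_op ::
    "('x \<Rightarrow> 'x \<Rightarrow> 'x) \<Rightarrow> ('x \<Rightarrow> 'x \<Rightarrow> 'x) \<Rightarrow> 'x \<times> 'x \<Rightarrow> 'x \<times> 'x \<Rightarrow> 'x \<times> 'x" where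
  "double_op tri0 tri1 =
     (\<lambda>(x0, x1) (y0, y1). ((x0 \<triangleleft>\<^sub>0 y0) \<triangleleft>\<^sub>1 y1, (x1 \<triangleleft>\<^sub>0 y0) \<triangleleft>\<^sub>1 y1))"
  for tri0 (infixl "\<triangleleft>\<^sub>0" 70) and tri1 (infixl "\<triangleleft>\<^sub>1" 70)

definition double_cochain ::
    "'x set \<Rightarrow> ('x \<Rightarrow> 'x \<Rightarrow> 'x) \<Rightarrow> ('a, 'm) monoid_scheme \<Rightarrow>
     ('x \<times> 'x \<Rightarrow> 'a) \<Rightarrow> ('x \<times> 'x \<Rightarrow> 'a) \<Rightarrow> ('x \<times> 'x) \<times> ('x \<times> 'x) \<Rightarrow> 'a" where
  "double_cochain X tri0 A \<phi>0 \<phi>1 =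
     (\<lambda>((x0, x1), (y0, y1)) \<in> (X \<times> X) \<times> (X \<times> X).
        \<phi>0 (x0, y0) \<otimes>\<^bsub>A\<^esub> \<phi>1 (x0 \<triangleleft>\<^sub>0 y0, y1) \<otimes>\<^bsub>A\<^esub> \<phi>0 (x1, y0) \<otimes>\<^bsub>A\<^esub> \<phi>1 (x1 \<triangleleft>\<^sub>0 y0, y1))"
  for tri0 (infixl "\<triangleleft>\<^sub>0" 70)

end

theory Submission
  imports Defs
begin

text \<open>
  The right translations \<open>x \<mapsto> (x \<triangleleft>\<^sub>0 z0) \<triangleleft>\<^sub>1 z1\<close> are automorphisms of both racks, which makes the
  doubled operation a rack. The doubled cochain is the sum of the two values of
  \<open>\<psi>(x, y) = \<phi>0(x, y0) + \<phi>1(x \<triangleleft>\<^sub>0 y0, y1)\<close> at the components of the first argument, and \<open>\<psi>\<close> itself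
  satisfies the cocycle identity: moving the strands \<open>z0\<close>, \<open>z1\<close> past \<open>y0\<close>, \<open>y1\<close> takes two cocycle
  identities and both mixed ones. On the coboundaries of \<open>f\<close> the sum defining \<open>\<psi>\<close> telescopes, so they
  are sent to the coboundary of \<open>(x0, x1) \<mapsto> f x0 + f x1\<close>, and cohomology classes are respected.
\<close>

section \<open>Descending a map along a quotient\<close>

lemma ex1_PiE_factor:
  assumes h: "\<And>p. p \<in> Z \<Longrightarrow> h p \<in> D"
    and compat: "\<And>p p'. \<lbrakk>p \<in> Z; p' \<in> Z; q p = q p'\<rbrakk> \<Longrightarrow> h p = h p'"
  shows "\<exists>!\<Theta>. \<Theta> \<in> q ` Z \<rightarrow>\<^sub>E D \<and> (\<forall>p\<in>Z. \<Theta> (q p) = h p)"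
proof (rule ex1I)
  \<comment> \<open>A representative is picked by \<open>inv_into\<close>; by \<open>compat\<close>,
    any other one gives the same value.\<close>
  let ?\<Theta> = "\<lambda>c\<in>q ` Z. h (inv_into Z q c)"
  have eq: "?\<Theta> (q p) = h p" if "p \<in> Z" for p
  proof -
    have "q p \<in> q ` Z" using that by (rule imageI)
    then have "h (inv_into Z q (q p)) = h p"
      by (intro compat inv_into_into f_inv_into_f that)
    then show ?thesis using that by simp
  qed
  then show "?\<Theta> \<in> q ` Z \<rightarrow>\<^sub>E D \<and> (\<forall>p\<in>Z. ?\<Theta> (q p) = h p)"
    by (intro conjI ballI PiE_I) (auto intro!: h inv_into_into)
  show "\<Theta> = ?\<Theta>" if "\<Theta> \<in> q ` Z \<rightarrow>\<^sub>E D \<and> (\<forall>p\<in>Z. \<Theta> (q p) = h p)" for \<Theta>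
    using that eq by (intro PiE_ext[of \<Theta> "q ` Z" "\<lambda>_. D"]) (auto intro!: h inv_into_into)
qed

section \<open>Coboundaries and their cosets\<close>

text \<open>The coset arithmetic below needs this fact itself, whereas
  \<open>comm_group_rack_H2\<close> exports only its consequence for the quotient. Closure comes
  from the coboundary being additive in \<open>f\<close>.\<close>

lemma (in rack) rack_B2_subgroup:
  assumes "comm_group A"
  shows "subgroup (rack_B2 X (\<triangleleft>) A) (rack_Z2 X (\<triangleleft>) A)"
proof -
  interpret A: comm_group A by fact
  let ?C = "cochain_group X A"
  interpret C: comm_group ?C
    by (rule comm_group_cochain_group[OF assms])
  have Z: "rack_Z2 X (\<triangleleft>) A = ?C\<lparr>carrier := carrier (rack_Z2 X (\<triangleleft>) A)\<rparr>"
    by (simp add: rack_Z2_def)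
  have "subgroup (rack_B2 X (\<triangleleft>) A) ?C"
  proof (rule C.subgroupI)
    show "rack_B2 X (\<triangleleft>) A \<subseteq> carrier ?C"
      unfolding rack_B2_def using coboundary_cochain[OF assms] by blast
    show "rack_B2 X (\<triangleleft>) A \<noteq> {}" by (auto simp: rack_B2_def)
  next
    fix \<phi> assume "\<phi> \<in> rack_B2 X (\<triangleleft>) A"
    then obtain f where f: "f \<in> X \<rightarrow> carrier A" "\<phi> = coboundary X (\<triangleleft>) A f"
      by (auto simp: rack_B2_def)
    have "(\<lambda>x. inv\<^bsub>A\<^esub> f x) \<in> X \<rightarrow> carrier A" using f(1) by auto
    then show "inv\<^bsub>?C\<^esub> \<phi> \<in> rack_B2 X (\<triangleleft>) A"
      unfolding f(2) coboundary_inv[OF assms f(1)] rack_B2_def by (rule imageI)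
  next
    fix \<phi> \<psi> assume "\<phi> \<in> rack_B2 X (\<triangleleft>) A" "\<psi> \<in> rack_B2 X (\<triangleleft>) A"
    then obtain f g where fg: "f \<in> X \<rightarrow> carrier A" "g \<in> X \<rightarrow> carrier A"
      "\<phi> = coboundary X (\<triangleleft>) A f" "\<psi> = coboundary X (\<triangleleft>) A g"
      by (auto simp: rack_B2_def)
    have "(\<lambda>x. f x \<otimes>\<^bsub>A\<^esub> g x) \<in> X \<rightarrow> carrier A" using fg(1,2) by auto
    then show "\<phi> \<otimes>\<^bsub>?C\<^esub> \<psi> \<in> rack_B2 X (\<triangleleft>) A"
      unfolding fg(3,4) coboundary_mult[OF assms fg(1,2)] rack_B2_def by (rule imageI)
  qed
  moreover have "rack_B2 X (\<triangleleft>) A \<subseteq> carrier (rack_Z2 X (\<triangleleft>) A)"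
    using coboundary_2cocycle[OF assms] coboundary_cochain[OF assms]
    unfolding rack_B2_def rack_Z2_def by auto
  ultimately show ?thesis
    using C.subgroup_incl[OF _ rack_2cocycle_subgroup[OF assms]] Z by simp
qed

text \<open>A coset absorbs elements of its own subgroup: B + (b + \<phi>) = (B + b) + \<phi>, and B
  + b = B for b in B.\<close>

lemma (in rack) rack_class_coboundary_mult:
  assumes "comm_group A" "f \<in> X \<rightarrow> carrier A" "\<phi> \<in> carrier (rack_Z2 X (\<triangleleft>) A)"
  shows "rack_class X (\<triangleleft>) A (coboundary X (\<triangleleft>) A f \<otimes>\<^bsub>cochain_group X A\<^esub> \<phi>) =
    rack_class X (\<triangleleft>) A \<phi>"
proof -
  let ?Z = "rack_Z2 X (\<triangleleft>) A" and ?B = "rack_B2 X (\<triangleleft>) A" and ?b = "coboundary X (\<triangleleft>) A f"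
  interpret C: comm_group "cochain_group X A"
    by (rule comm_group_cochain_group[OF assms(1)])
  have Z: "?Z = (cochain_group X A)\<lparr>carrier := carrier ?Z\<rparr>"
    by (simp add: rack_Z2_def)
  interpret Z: group ?Z
    using C.subgroup_imp_group[OF rack_2cocycle_subgroup[OF assms(1)]] Z by simp
  note B = rack_B2_subgroup[OF assms(1)]
  have b: "?b \<in> ?B"
    unfolding rack_B2_def using assms(2) by (rule imageI)
  have bZ: "?b \<in> carrier ?Z"
    using subgroup.mem_carrier[OF B b] .
  have "?B #>\<^bsub>?Z\<^esub> (?b \<otimes>\<^bsub>?Z\<^esub> \<phi>) = (?B #>\<^bsub>?Z\<^esub> ?b) #>\<^bsub>?Z\<^esub> \<phi>"
    using Z.coset_mult_assoc[OF subgroup.subset[OF B] bZ assms(3)] by simp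
  also have "?B #>\<^bsub>?Z\<^esub> ?b = ?B"
    using Z.coset_join2[OF bZ B b] .
  also have "?b \<otimes>\<^bsub>?Z\<^esub> \<phi> = ?b \<otimes>\<^bsub>cochain_group X A\<^esub> \<phi>"
    by (simp add: rack_Z2_def)
  finally show ?thesis
    unfolding rack_class_def .
qed

section \<open>The doubled rack\<close>

context mutually_distributive_racks
begin

lemma bij_betw_comp_right:
  assumes "y0 \<in> X" "y1 \<in> X"
  shows "bij_betw (\<lambda>x. (x \<triangleleft>\<^sub>0 y0) \<triangleleft>\<^sub>1 y1) X X"
  using bij_betw_trans[OF r0.bij_right[OF assms(1)] r1.bij_right[OF assms(2)]]
  by (simp add: comp_def)

text \<open>Translation by \<open>z0\<close>, then by \<open>z1\<close>, is a composite of two maps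
  that respect both operations. Each of the two self-distributive and two mixed laws handles one
  operation under one of these translations.\<close>

lemma comp_right_distrib:
  assumes "a \<in> X" "b \<in> X" "z0 \<in> X" "z1 \<in> X"
  shows "((a \<triangleleft>\<^sub>0 b) \<triangleleft>\<^sub>0 z0) \<triangleleft>\<^sub>1 z1 = ((a \<triangleleft>\<^sub>0 z0) \<triangleleft>\<^sub>1 z1) \<triangleleft>\<^sub>0 ((b \<triangleleft>\<^sub>0 z0) \<triangleleft>\<^sub>1 z1)"
    and "((a \<triangleleft>\<^sub>1 b) \<triangleleft>\<^sub>0 z0) \<triangleleft>\<^sub>1 z1 = ((a \<triangleleft>\<^sub>0 z0) \<triangleleft>\<^sub>1 z1) \<triangleleft>\<^sub>1 ((b \<triangleleft>\<^sub>0 z0) \<triangleleft>\<^sub>1 z1)"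
  using assms
  by (simp_all only: r0.closed r1.closed r0.self_distrib[of a b z0] distrib10[of a b z0]
      distrib01[of "a \<triangleleft>\<^sub>0 z0" "b \<triangleleft>\<^sub>0 z0" z1] r1.self_distrib[of "a \<triangleleft>\<^sub>0 z0" "b \<triangleleft>\<^sub>0 z0" z1])

lemma rack_double: "rack (X \<times> X) (double_op (\<triangleleft>\<^sub>0) (\<triangleleft>\<^sub>1))"
proof
  fix y assume "y \<in> X \<times> X"
  then obtain y0 y1 where y: "y = (y0, y1)" "y0 \<in> X" "y1 \<in> X" by auto
  \<comment> \<open>Translation by a fixed \<open>y\<close> acts on both coordinates by the same
    bijection of \<open>X\<close>.\<close>
  have "(\<lambda>x. double_op (\<triangleleft>\<^sub>0) (\<triangleleft>\<^sub>1) x y) =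
      map_prod (\<lambda>x. (x \<triangleleft>\<^sub>0 y0) \<triangleleft>\<^sub>1 y1) (\<lambda>x. (x \<triangleleft>\<^sub>0 y0) \<triangleleft>\<^sub>1 y1)"
    by (auto simp: double_op_def y(1))
  then show "bij_betw (\<lambda>x. double_op (\<triangleleft>\<^sub>0) (\<triangleleft>\<^sub>1) x y) (X \<times> X) (X \<times> X)"
    using bij_betw_map_prod[OF bij_betw_comp_right[OF y(2,3)] bij_betw_comp_right[OF y(2,3)]] by simp
next
  fix a b c assume "a \<in> X \<times> X" "b \<in> X \<times> X" "c \<in> X \<times> X"
  then obtain a0 a1 b0 b1 c0 c1 where abc: "a = (a0, a1)" "b = (b0, b1)" "c = (c0, c1)"
    and X: "a0 \<in> X" "a1 \<in> X" "b0 \<in> X" "b1 \<in> X" "c0 \<in> X" "c1 \<in> X" by auto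
  \<comment> \<open>Both coordinates of the first argument obey one formula, so a single
    \<open>x\<close> covers \<open>a0\<close> and \<open>a1\<close>. The translation by
    \<open>c0\<close>, \<open>c1\<close> is pushed first through the outer
    \<open>\<triangleleft>\<^sub>1 b1\<close>, then through
    \<open>\<triangleleft>\<^sub>0 b0\<close>.\<close>
  have "(((x \<triangleleft>\<^sub>0 b0) \<triangleleft>\<^sub>1 b1) \<triangleleft>\<^sub>0 c0) \<triangleleft>\<^sub>1 c1 =
      (((x \<triangleleft>\<^sub>0 c0) \<triangleleft>\<^sub>1 c1) \<triangleleft>\<^sub>0 ((b0 \<triangleleft>\<^sub>0 c0) \<triangleleft>\<^sub>1 c1)) \<triangleleft>\<^sub>1 ((b1 \<triangleleft>\<^sub>0 c0) \<triangleleft>\<^sub>1 c1)" if "x \<in> X" for x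
    using that X by (simp add: comp_right_distrib(1)[of x b0 c0 c1]
        comp_right_distrib(2)[of "x \<triangleleft>\<^sub>0 b0" b1 c0 c1] r0.closed r1.closed)
  then show "double_op (\<triangleleft>\<^sub>0) (\<triangleleft>\<^sub>1) (double_op (\<triangleleft>\<^sub>0) (\<triangleleft>\<^sub>1) a b) c =
      double_op (\<triangleleft>\<^sub>0) (\<triangleleft>\<^sub>1) (double_op (\<triangleleft>\<^sub>0) (\<triangleleft>\<^sub>1) a c) (double_op (\<triangleleft>\<^sub>0) (\<triangleleft>\<^sub>1) b c)"
    using X by (simp add: double_op_def abc)
qed (auto simp: double_op_def r0.closed r1.closed)

section \<open>The doubled cocycle\<close>

text \<open>The word y0 y1 z0 z1 is rearranged into z0 z1 y0 y1 by four adjacent exchanges.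
  Exchanges of equal labels use a cocycle identity, those of different labels a mixed one. Each
  exchange also lets the strand moving left act on the one it passes.\<close>

lemma half_cocycle_eq:
  assumes "comm_group A"
    and c0: "rack_2cocycle X (\<triangleleft>\<^sub>0) A \<phi>0" and c1: "rack_2cocycle X (\<triangleleft>\<^sub>1) A \<phi>1"
    and m: "mutually_distributive_pair X (\<triangleleft>\<^sub>0) (\<triangleleft>\<^sub>1) A \<phi>0 \<phi>1"
    and X: "x \<in> X" "y0 \<in> X" "y1 \<in> X" "z0 \<in> X" "z1 \<in> X"
  defines "\<psi> \<equiv> \<lambda>x y0 y1. \<phi>0 (x, y0) \<otimes>\<^bsub>A\<^esub> \<phi>1 (x \<triangleleft>\<^sub>0 y0, y1)"
  shows "\<psi> x y0 y1 \<otimes>\<^bsub>A\<^esub> \<psi> ((x \<triangleleft>\<^sub>0 y0) \<triangleleft>\<^sub>1 y1) z0 z1 =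
    \<psi> x z0 z1 \<otimes>\<^bsub>A\<^esub> \<psi> ((x \<triangleleft>\<^sub>0 z0) \<triangleleft>\<^sub>1 z1) ((y0 \<triangleleft>\<^sub>0 z0) \<triangleleft>\<^sub>1 z1) ((y1 \<triangleleft>\<^sub>0 z0) \<triangleleft>\<^sub>1 z1)"
proof -
  interpret A: comm_group A by fact
  note [simp] = X r0.closed r1.closed rack_2cocycle_closed[OF c0] rack_2cocycle_closed[OF c1]
  let ?u = "x \<triangleleft>\<^sub>0 y0" and ?x = "x \<triangleleft>\<^sub>0 z0" and ?y0 = "y0 \<triangleleft>\<^sub>0 z0" and ?y1 = "y1 \<triangleleft>\<^sub>0 z0"
  have "\<psi> x y0 y1 \<otimes>\<^bsub>A\<^esub> \<psi> (?u \<triangleleft>\<^sub>1 y1) z0 z1 =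
      \<phi>0 (x, y0) \<otimes>\<^bsub>A\<^esub> (\<phi>1 (?u, y1) \<otimes>\<^bsub>A\<^esub> \<phi>0 (?u \<triangleleft>\<^sub>1 y1, z0)) \<otimes>\<^bsub>A\<^esub> \<phi>1 ((?u \<triangleleft>\<^sub>1 y1) \<triangleleft>\<^sub>0 z0, z1)"
    by (simp add: \<psi>_def A.m_assoc)
  \<comment> \<open>First exchange: \<open>z0\<close> passes \<open>y1\<close>. The labels differ,
    so this is a mixed identity.\<close>
  also have "\<phi>1 (?u, y1) \<otimes>\<^bsub>A\<^esub> \<phi>0 (?u \<triangleleft>\<^sub>1 y1, z0) = \<phi>0 (?u, z0) \<otimes>\<^bsub>A\<^esub> \<phi>1 (?u \<triangleleft>\<^sub>0 z0, ?y1)"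
    by (rule mutually_distributive_pair_eq(2)[OF m]) simp_all
  also have "(?u \<triangleleft>\<^sub>1 y1) \<triangleleft>\<^sub>0 z0 = (?u \<triangleleft>\<^sub>0 z0) \<triangleleft>\<^sub>1 ?y1"
    by (rule distrib10) simp_all
  \<comment> \<open>Regrouping brings the two \<phi>0 factors together and the two \<phi>1 factors
    together, ready for the exchanges with equal labels.\<close>
  also have "\<phi>0 (x, y0) \<otimes>\<^bsub>A\<^esub> (\<phi>0 (?u, z0) \<otimes>\<^bsub>A\<^esub> \<phi>1 (?u \<triangleleft>\<^sub>0 z0, ?y1)) \<otimes>\<^bsub>A\<^esub>
        \<phi>1 ((?u \<triangleleft>\<^sub>0 z0) \<triangleleft>\<^sub>1 ?y1, z1) =
      (\<phi>0 (x, y0) \<otimes>\<^bsub>A\<^esub> \<phi>0 (?u, z0)) \<otimes>\<^bsub>A\<^esub>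
        (\<phi>1 (?u \<triangleleft>\<^sub>0 z0, ?y1) \<otimes>\<^bsub>A\<^esub> \<phi>1 ((?u \<triangleleft>\<^sub>0 z0) \<triangleleft>\<^sub>1 ?y1, z1))"
    by (simp add: A.m_assoc)
  \<comment> \<open>Now \<open>z0\<close> passes \<open>y0\<close>, and next \<open>z1\<close>
    passes the already translated \<open>y1\<close>.\<close>
  also have "\<phi>0 (x, y0) \<otimes>\<^bsub>A\<^esub> \<phi>0 (?u, z0) = \<phi>0 (x, z0) \<otimes>\<^bsub>A\<^esub> \<phi>0 (?x, ?y0)"
    by (rule rack_2cocycle_eq[OF c0]) simp_all
  also have "\<phi>1 (?u \<triangleleft>\<^sub>0 z0, ?y1) \<otimes>\<^bsub>A\<^esub> \<phi>1 ((?u \<triangleleft>\<^sub>0 z0) \<triangleleft>\<^sub>1 ?y1, z1) =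
      \<phi>1 (?u \<triangleleft>\<^sub>0 z0, z1) \<otimes>\<^bsub>A\<^esub> \<phi>1 ((?u \<triangleleft>\<^sub>0 z0) \<triangleleft>\<^sub>1 z1, ?y1 \<triangleleft>\<^sub>1 z1)"
    by (rule rack_2cocycle_eq[OF c1]) simp_all
  \<comment> \<open>The base point must be written with \<open>z0\<close> acting before
    \<open>y0\<close>, so that the last mixed identity can start from \<open>?x\<close>.\<close>
  also have "?u \<triangleleft>\<^sub>0 z0 = ?x \<triangleleft>\<^sub>0 ?y0"
    by (rule r0.self_distrib) simp_all
  also have "(\<phi>0 (x, z0) \<otimes>\<^bsub>A\<^esub> \<phi>0 (?x, ?y0)) \<otimes>\<^bsub>A\<^esub>
        (\<phi>1 (?x \<triangleleft>\<^sub>0 ?y0, z1) \<otimes>\<^bsub>A\<^esub> \<phi>1 ((?x \<triangleleft>\<^sub>0 ?y0) \<triangleleft>\<^sub>1 z1, ?y1 \<triangleleft>\<^sub>1 z1)) =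
      \<phi>0 (x, z0) \<otimes>\<^bsub>A\<^esub> (\<phi>0 (?x, ?y0) \<otimes>\<^bsub>A\<^esub> \<phi>1 (?x \<triangleleft>\<^sub>0 ?y0, z1)) \<otimes>\<^bsub>A\<^esub>
        \<phi>1 ((?x \<triangleleft>\<^sub>0 ?y0) \<triangleleft>\<^sub>1 z1, ?y1 \<triangleleft>\<^sub>1 z1)"
    by (simp add: A.m_assoc)
  \<comment> \<open>Last exchange: \<open>z1\<close> passes the translated
    \<open>y0\<close>.\<close>
  also have "\<phi>0 (?x, ?y0) \<otimes>\<^bsub>A\<^esub> \<phi>1 (?x \<triangleleft>\<^sub>0 ?y0, z1) =
      \<phi>1 (?x, z1) \<otimes>\<^bsub>A\<^esub> \<phi>0 (?x \<triangleleft>\<^sub>1 z1, ?y0 \<triangleleft>\<^sub>1 z1)"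
    by (rule mutually_distributive_pair_eq(1)[OF m]) simp_all
  also have "(?x \<triangleleft>\<^sub>0 ?y0) \<triangleleft>\<^sub>1 z1 = (?x \<triangleleft>\<^sub>1 z1) \<triangleleft>\<^sub>0 (?y0 \<triangleleft>\<^sub>1 z1)"
    by (rule distrib01) simp_all
  finally show ?thesis
    by (simp add: \<psi>_def A.m_assoc)
qed

lemma double_cochain_2cocycle:
  assumes "comm_group A"
    and c0: "rack_2cocycle X (\<triangleleft>\<^sub>0) A \<phi>0" and c1: "rack_2cocycle X (\<triangleleft>\<^sub>1) A \<phi>1"
    and m: "mutually_distributive_pair X (\<triangleleft>\<^sub>0) (\<triangleleft>\<^sub>1) A \<phi>0 \<phi>1"
  shows "rack_2cocycle (X \<times> X) (double_op (\<triangleleft>\<^sub>0) (\<triangleleft>\<^sub>1)) A (double_cochain X (\<triangleleft>\<^sub>0) A \<phi>0 \<phi>1)"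
proof -
  interpret A: comm_group A by fact
  note [simp] = r0.closed r1.closed rack_2cocycle_closed[OF c0] rack_2cocycle_closed[OF c1]
  \<comment> \<open>The four factors are bracketed as two halves, one per coordinate of the first
    argument. In this shape \<open>mult_eq_interchange\<close> multiplies the two instances of
    \<open>half_cocycle_eq\<close>.\<close>
  have split: "double_cochain X (\<triangleleft>\<^sub>0) A \<phi>0 \<phi>1 ((x0, x1), (y0, y1)) =
      (\<phi>0 (x0, y0) \<otimes>\<^bsub>A\<^esub> \<phi>1 (x0 \<triangleleft>\<^sub>0 y0, y1)) \<otimes>\<^bsub>A\<^esub> (\<phi>0 (x1, y0) \<otimes>\<^bsub>A\<^esub> \<phi>1 (x1 \<triangleleft>\<^sub>0 y0, y1))"
    if "x0 \<in> X" "x1 \<in> X" "y0 \<in> X" "y1 \<in> X" for x0 x1 y0 y1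
    using that by (simp add: double_cochain_def A.m_assoc)
  show ?thesis
    unfolding rack_2cocycle_def
    by (auto simp: split double_op_def
        intro!: A.mult_eq_interchange half_cocycle_eq[OF assms])
qed

section \<open>Doubling of products and of coboundaries\<close>

text \<open>Commutativity lets the eight factors be sorted pointwise. Both sides are restricted to
  the same domain, so they are equal as functions, as the comparison of cosets requires.\<close>

lemma double_cochain_mult:
  assumes "comm_group A"
    and c0: "\<phi>0 \<in> X \<times> X \<rightarrow> carrier A" "\<psi>0 \<in> X \<times> X \<rightarrow> carrier A"
    and c1: "\<phi>1 \<in> X \<times> X \<rightarrow> carrier A" "\<psi>1 \<in> X \<times> X \<rightarrow> carrier A"
  shows "double_cochain X (\<triangleleft>\<^sub>0) A (\<phi>0 \<otimes>\<^bsub>cochain_group X A\<^esub> \<psi>0) (\<phi>1 \<otimes>\<^bsub>cochain_group X A\<^esub> \<psi>1) =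
    double_cochain X (\<triangleleft>\<^sub>0) A \<phi>0 \<phi>1 \<otimes>\<^bsub>cochain_group (X \<times> X) A\<^esub> double_cochain X (\<triangleleft>\<^sub>0) A \<psi>0 \<psi>1"
proof -
  interpret A: comm_group A by fact
  have [simp]: "\<phi>0 (x, y) \<in> carrier A" "\<psi>0 (x, y) \<in> carrier A"
      "\<phi>1 (x, y) \<in> carrier A" "\<psi>1 (x, y) \<in> carrier A" if "x \<in> X" "y \<in> X" for x y
    using assms(2-) that by auto
  show ?thesis
    by (auto simp: double_cochain_def restrict_def fun_eq_iff r0.closed A.m_ac)
qed

lemma double_cochain_coboundary:
  assumes "comm_group A" "f \<in> X \<rightarrow> carrier A"
  shows "double_cochain X (\<triangleleft>\<^sub>0) A (coboundary X (\<triangleleft>\<^sub>0) A f) (coboundary X (\<triangleleft>\<^sub>1) A f) =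
    coboundary (X \<times> X) (double_op (\<triangleleft>\<^sub>0) (\<triangleleft>\<^sub>1)) A (\<lambda>(x0, x1). f x0 \<otimes>\<^bsub>A\<^esub> f x1)"
proof -
  interpret A: comm_group A by fact
  have [simp]: "f x \<in> carrier A" if "x \<in> X" for x using assms(2) that by auto
  \<comment> \<open>The values a, b, c are those of \<open>f\<close> at \<open>x0\<close>, at
    \<open>x0 \<triangleleft>\<^sub>0 y0\<close> and at
    \<open>(x0 \<triangleleft>\<^sub>0 y0) \<triangleleft>\<^sub>1 y1\<close>; the primed ones
    belong to \<open>x1\<close>. The bracketing is that of the unfolded goal.\<close>
  have "a \<otimes>\<^bsub>A\<^esub> inv\<^bsub>A\<^esub> b \<otimes>\<^bsub>A\<^esub> (b \<otimes>\<^bsub>A\<^esub> inv\<^bsub>A\<^esub> c) \<otimes>\<^bsub>A\<^esub> (a' \<otimes>\<^bsub>A\<^esub> inv\<^bsub>A\<^esub> b') \<otimes>\<^bsub>A\<^esub> (b' \<otimes>\<^bsub>A\<^esub> inv\<^bsub>A\<^esub> c') =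
      a \<otimes>\<^bsub>A\<^esub> a' \<otimes>\<^bsub>A\<^esub> inv\<^bsub>A\<^esub> (c \<otimes>\<^bsub>A\<^esub> c')"
    if "a \<in> carrier A" "b \<in> carrier A" "c \<in> carrier A"
      "a' \<in> carrier A" "b' \<in> carrier A" "c' \<in> carrier A" for a b c a' b' c'
  proof -
    have "a \<otimes>\<^bsub>A\<^esub> inv\<^bsub>A\<^esub> b \<otimes>\<^bsub>A\<^esub> (b \<otimes>\<^bsub>A\<^esub> inv\<^bsub>A\<^esub> c) \<otimes>\<^bsub>A\<^esub> (a' \<otimes>\<^bsub>A\<^esub> inv\<^bsub>A\<^esub> b') \<otimes>\<^bsub>A\<^esub> (b' \<otimes>\<^bsub>A\<^esub> inv\<^bsub>A\<^esub> c') =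
        (a \<otimes>\<^bsub>A\<^esub> inv\<^bsub>A\<^esub> c) \<otimes>\<^bsub>A\<^esub> ((a' \<otimes>\<^bsub>A\<^esub> inv\<^bsub>A\<^esub> b') \<otimes>\<^bsub>A\<^esub> (b' \<otimes>\<^bsub>A\<^esub> inv\<^bsub>A\<^esub> c'))"
      using that by (simp only: A.mult_inv_cancel_middle[of a b c]) (simp add: A.m_assoc)
    also have "\<dots> = (a \<otimes>\<^bsub>A\<^esub> inv\<^bsub>A\<^esub> c) \<otimes>\<^bsub>A\<^esub> (a' \<otimes>\<^bsub>A\<^esub> inv\<^bsub>A\<^esub> c')"
      using that by (simp only: A.mult_inv_cancel_middle)
    also have "\<dots> = a \<otimes>\<^bsub>A\<^esub> a' \<otimes>\<^bsub>A\<^esub> inv\<^bsub>A\<^esub> (c \<otimes>\<^bsub>A\<^esub> c')"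
      using that by (simp add: A.inv_mult A.m_ac)
    finally show ?thesis .
  qed
  then show ?thesis
    by (auto simp: double_cochain_def coboundary_def double_op_def restrict_def fun_eq_iff
        r0.closed r1.closed)
qed

text \<open>The cocycle property puts the values in \<open>A\<close>; the restriction in
  \<open>double_cochain\<close> gives the extensionality that a cochain needs.\<close>

lemma double_cochain_in_Z2:
  assumes "comm_group A" "(\<phi>0, \<phi>1) \<in> carrier (labeled_Z2 X (\<triangleleft>\<^sub>0) (\<triangleleft>\<^sub>1) A)"
  shows "double_cochain X (\<triangleleft>\<^sub>0) A \<phi>0 \<phi>1 \<in> carrier (rack_Z2 (X \<times> X) (double_op (\<triangleleft>\<^sub>0) (\<triangleleft>\<^sub>1)) A)"
proof -
  have c: "rack_2cocycle (X \<times> X) (double_op (\<triangleleft>\<^sub>0) (\<triangleleft>\<^sub>1)) A (double_cochain X (\<triangleleft>\<^sub>0) A \<phi>0 \<phi>1)"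
    using assms(2) by (intro double_cochain_2cocycle assms(1)) (auto simp: labeled_Z2_def)
  moreover have "double_cochain X (\<triangleleft>\<^sub>0) A \<phi>0 \<phi>1 \<in> extensional ((X \<times> X) \<times> (X \<times> X))"
    by (simp add: double_cochain_def)
  ultimately show ?thesis
    by (auto simp: rack_Z2_def PiE_def rack_2cocycle_def)
qed

section \<open>Independence of the representative\<close>

text \<open>A pair lies in its own coset, hence in any coset equal to it. Both components are
  shifted by the same \<open>f\<close> because \<open>labeled_B2\<close> is parametrised by a single
  map.\<close>

lemma labeled_class_eqD:
  assumes "comm_group A"
    and p: "(\<phi>0, \<phi>1) \<in> carrier (labeled_Z2 X (\<triangleleft>\<^sub>0) (\<triangleleft>\<^sub>1) A)"
    and eq: "labeled_class X (\<triangleleft>\<^sub>0) (\<triangleleft>\<^sub>1) A \<phi>0 \<phi>1 = labeled_class X (\<triangleleft>\<^sub>0) (\<triangleleft>\<^sub>1) A \<psi>0 \<psi>1"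
  obtains f where "f \<in> X \<rightarrow> carrier A"
    and "\<phi>0 = coboundary X (\<triangleleft>\<^sub>0) A f \<otimes>\<^bsub>cochain_group X A\<^esub> \<psi>0"
    and "\<phi>1 = coboundary X (\<triangleleft>\<^sub>1) A f \<otimes>\<^bsub>cochain_group X A\<^esub> \<psi>1"
proof -
  interpret A: comm_group A by fact
  let ?C = "cochain_group X A" and ?Z = "labeled_Z2 X (\<triangleleft>\<^sub>0) (\<triangleleft>\<^sub>1) A"
  interpret C: comm_group ?C
    by (rule comm_group_cochain_group[OF assms(1)])
  have Z: "(a, b) \<otimes>\<^bsub>?Z\<^esub> (c, d) = (a \<otimes>\<^bsub>?C\<^esub> c, b \<otimes>\<^bsub>?C\<^esub> d)" for a b c d
    by (simp add: labeled_Z2_def)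
  have "\<phi>0 \<in> carrier ?C" "\<phi>1 \<in> carrier ?C"
    using p by (auto simp: labeled_Z2_def)
  then have one: "(\<phi>0, \<phi>1) = (\<one>\<^bsub>?C\<^esub>, \<one>\<^bsub>?C\<^esub>) \<otimes>\<^bsub>?Z\<^esub> (\<phi>0, \<phi>1)"
    by (simp only: Z C.l_one)
  \<comment> \<open>The constant map to the neutral element has trivial coboundaries, which places
    the neutral pair in \<open>labeled_B2\<close>.\<close>
  have "(\<lambda>_. \<one>\<^bsub>A\<^esub>) \<in> X \<rightarrow> carrier A" by simp
  then have "(\<one>\<^bsub>?C\<^esub>, \<one>\<^bsub>?C\<^esub>) \<in> labeled_B2 X (\<triangleleft>\<^sub>0) (\<triangleleft>\<^sub>1) A"
    unfolding labeled_B2_def by (rule image_eqI[rotated]) (simp only: coboundary_one[OF assms(1)])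
  then have "(\<phi>0, \<phi>1) \<in> labeled_class X (\<triangleleft>\<^sub>0) (\<triangleleft>\<^sub>1) A \<phi>0 \<phi>1"
    unfolding labeled_class_def r_coset_def using one by blast
  then have "(\<phi>0, \<phi>1) \<in> labeled_class X (\<triangleleft>\<^sub>0) (\<triangleleft>\<^sub>1) A \<psi>0 \<psi>1"
    by (simp only: eq)
  then obtain b where "b \<in> labeled_B2 X (\<triangleleft>\<^sub>0) (\<triangleleft>\<^sub>1) A" and \<phi>: "(\<phi>0, \<phi>1) = b \<otimes>\<^bsub>?Z\<^esub> (\<psi>0, \<psi>1)"
    unfolding labeled_class_def r_coset_def by (elim UN_E singletonE)
  then obtain f where "f \<in> X \<rightarrow> carrier A" and "b = (coboundary X (\<triangleleft>\<^sub>0) A f, coboundary X (\<triangleleft>\<^sub>1) A f)"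
    unfolding labeled_B2_def by (elim imageE)
  then show thesis
    using that \<phi> by (simp only: Z prod.inject)
qed

text \<open>The two pairs differ by the coboundaries of one \<open>f\<close>. Doubling is
  multiplicative and turns these into a coboundary on the doubled rack, which the rack class
  absorbs.\<close>

lemma rack_class_double_cochain_cong:
  assumes "comm_group A"
    and p: "(\<phi>0, \<phi>1) \<in> carrier (labeled_Z2 X (\<triangleleft>\<^sub>0) (\<triangleleft>\<^sub>1) A)"
    and q: "(\<psi>0, \<psi>1) \<in> carrier (labeled_Z2 X (\<triangleleft>\<^sub>0) (\<triangleleft>\<^sub>1) A)"
    and eq: "labeled_class X (\<triangleleft>\<^sub>0) (\<triangleleft>\<^sub>1) A \<phi>0 \<phi>1 = labeled_class X (\<triangleleft>\<^sub>0) (\<triangleleft>\<^sub>1) A \<psi>0 \<psi>1"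
  shows "rack_class (X \<times> X) (double_op (\<triangleleft>\<^sub>0) (\<triangleleft>\<^sub>1)) A (double_cochain X (\<triangleleft>\<^sub>0) A \<phi>0 \<phi>1) =
    rack_class (X \<times> X) (double_op (\<triangleleft>\<^sub>0) (\<triangleleft>\<^sub>1)) A (double_cochain X (\<triangleleft>\<^sub>0) A \<psi>0 \<psi>1)"
proof -
  interpret A: comm_group A by fact
  obtain f where f: "f \<in> X \<rightarrow> carrier A"
    and \<phi>: "\<phi>0 = coboundary X (\<triangleleft>\<^sub>0) A f \<otimes>\<^bsub>cochain_group X A\<^esub> \<psi>0"
      "\<phi>1 = coboundary X (\<triangleleft>\<^sub>1) A f \<otimes>\<^bsub>cochain_group X A\<^esub> \<psi>1"
    using labeled_class_eqD[OF assms(1) p eq] .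
  let ?F = "\<lambda>(x0, x1). f x0 \<otimes>\<^bsub>A\<^esub> f x1"
  have F: "?F \<in> X \<times> X \<rightarrow> carrier A" using f by auto
  have "coboundary X (\<triangleleft>\<^sub>0) A f \<in> X \<times> X \<rightarrow> carrier A" "coboundary X (\<triangleleft>\<^sub>1) A f \<in> X \<times> X \<rightarrow> carrier A"
    using r0.coboundary_2cocycle[OF assms(1) f] r1.coboundary_2cocycle[OF assms(1) f]
    by (simp_all add: rack_2cocycle_def)
  moreover have "\<psi>0 \<in> X \<times> X \<rightarrow> carrier A" "\<psi>1 \<in> X \<times> X \<rightarrow> carrier A"
    using q by (auto simp: labeled_Z2_def)
  ultimately have "double_cochain X (\<triangleleft>\<^sub>0) A \<phi>0 \<phi>1 =
      coboundary (X \<times> X) (double_op (\<triangleleft>\<^sub>0) (\<triangleleft>\<^sub>1)) A ?F \<otimes>\<^bsub>cochain_group (X \<times> X) A\<^esub>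
        double_cochain X (\<triangleleft>\<^sub>0) A \<psi>0 \<psi>1"
    unfolding \<phi> by (simp only: double_cochain_mult[OF assms(1)] double_cochain_coboundary[OF assms(1) f])
  then show ?thesis
    using rack.rack_class_coboundary_mult[OF rack_double assms(1) F double_cochain_in_Z2[OF assms(1) q]]
    by (simp only:)
qed

end

text \<open>That the assignment induces a well-defined map is expressed as unique existence in the
  extensional function space between the cohomology groups. The cocycle claim covers arbitrary
  functions on pairs, extensional or not.\<close>

theorem theorem6p8:
  fixes X :: "'x set" and tri0 tri1 :: "'x \<Rightarrow> 'x \<Rightarrow> 'x" and A :: "('a, 'm) monoid_scheme"
  assumes "mutually_distributive_racks X tri0 tri1" and "comm_group A"
  shows "rack (X \<times> X) (double_op tri0 tri1) \<and>
    (\<forall>\<phi>0 \<phi>1. rack_2cocycle X tri0 A \<phi>0 \<longrightarrow> rack_2cocycle X tri1 A \<phi>1 \<longrightarrow>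
        mutually_distributive_pair X tri0 tri1 A \<phi>0 \<phi>1 \<longrightarrow>
        rack_2cocycle (X \<times> X) (double_op tri0 tri1) A (double_cochain X tri0 A \<phi>0 \<phi>1)) \<and>
    (\<exists>!\<Theta>. \<Theta> \<in> carrier (labeled_H2 X tri0 tri1 A)
               \<rightarrow>\<^sub>E carrier (rack_H2 (X \<times> X) (double_op tri0 tri1) A) \<and>
        (\<forall>(\<phi>0, \<phi>1) \<in> carrier (labeled_Z2 X tri0 tri1 A).
           \<Theta> (labeled_class X tri0 tri1 A \<phi>0 \<phi>1) =
             rack_class (X \<times> X) (double_op tri0 tri1) A (double_cochain X tri0 A \<phi>0 \<phi>1)))"
proof -
  interpret mutually_distributive_racks X tri0 tri1 by fact
  let ?q = "\<lambda>(\<phi>0, \<phi>1). labeled_class X tri0 tri1 A \<phi>0 \<phi>1"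
  let ?h = "\<lambda>(\<phi>0, \<phi>1).
    rack_class (X \<times> X) (double_op tri0 tri1) A (double_cochain X tri0 A \<phi>0 \<phi>1)"
  let ?Z = "carrier (labeled_Z2 X tri0 tri1 A)"
  \<comment> \<open>Every element of the quotient is a coset of some labeled cocycle pair, so the
    image of \<open>?q\<close> is the full domain required of \<Theta>.\<close>
  have carrier: "carrier (labeled_H2 X tri0 tri1 A) = ?q ` ?Z"
    by (auto simp: labeled_H2_def labeled_class_def FactGroup_def RCOSETS_def)
  have "\<exists>!\<Theta>. \<Theta> \<in> ?q ` ?Z \<rightarrow>\<^sub>E carrier (rack_H2 (X \<times> X) (double_op tri0 tri1) A) \<and>
      (\<forall>p\<in>?Z. \<Theta> (?q p) = ?h p)"
  proof (rule ex1_PiE_factor)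
    show "?h p \<in> carrier (rack_H2 (X \<times> X) (double_op tri0 tri1) A)" if "p \<in> ?Z" for p
      using that double_cochain_in_Z2[OF assms(2)]
      by (cases p) (auto simp: rack_H2_def rack_class_def FactGroup_def RCOSETS_def)
    show "?h p = ?h p'" if "p \<in> ?Z" "p' \<in> ?Z" "?q p = ?q p'" for p p'
    proof -
      obtain \<phi>0 \<phi>1 \<psi>0 \<psi>1 where p: "p = (\<phi>0, \<phi>1)" "p' = (\<psi>0, \<psi>1)"
        by (cases p, cases p')
      show ?thesis
        using that unfolding p prod.case by (rule rack_class_double_cochain_cong[OF assms(2)])
    qed
  qed
  then show ?thesis
    unfolding carrier
    using rack_double double_cochain_2cocycle[OF assms(2)] by (simp add: case_prod_unfold)
qed

end
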